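(* Assume that $W$ satisfies (W-i), (W-ii) and (W-iii), and write $W(s)=\frac12s^2+N(s)$ for $s\in\mathbb{R}^+$. If, for some $\alpha_0>0$, $$N(s)>0\qquad\forall\, s\in(0,\alpha_0),$$ then the nonlinear Klein-Gordon equation $\partial_t^2\psi-\Delta\psi+W'(\psi)=0$ in $\mathbb{R}^n$ is of type ($\alpha$).
   Context: Here $n\ge2$, and $W:\mathbb{C}\to\mathbb{R}$ has the form $W(\psi)=F(|\psi|)$ with $F:\mathbb{R}^+\to\mathbb{R}$ smooth; $W'(\psi)=F'(|\psi|)\psi/|\psi|$, and for $s\ge0$ one writes $W(s)=F(s)$. The assumptions are: (W-i) $W(s)\ge0$; (W-ii) $W(0)=W'(0)=0$, $W''(0)=1$; (W-iii) $\lambda_0:=\inf_{s>0}\frac{W(s)}{\frac12s^2}<1$. Type ($\alpha$): for $W$ satisfying (W-i), (W-ii), (W-iii), the equation is of type ($\alpha$) if there exists a constant $a>0$ such that any hylomorphic soliton $\psi(t,x)=u(x)e^{-i\omega t}$ satisfies $\|\psi(t,\cdot)\|_{L^\infty(\mathbb{R}^n)}\ge a$ for all $t\in\mathbb{R}$. The phase space is $X=H^1(\mathbb{R}^n,\mathbb{C})\times L^2(\mathbb{R}^n,\mathbb{C})$ with states $\Psi=(\psi,\psi_t)$; the time evolution $U_t$ of the equation on $X$ is assumed to be defined for all $t\in\mathbb{R}$. Energy and hylomorphic charge are $\mathcal{E}(\Psi)=\int[\frac12|\psi_t|^2+\frac12|\nabla\psi|^2+W(\psi)]dx$ and $\mathcal{H}(\Psi)=\int\mathrm{Im}(\psi_t\overline\psi)\,dx$.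 Since $W''(0)=1$, the hylomorphy ratio is $\Lambda(\Psi)=\mathcal{E}(\Psi)/|\mathcal{H}(\Psi)|$. The barycenter of a state is $q_\Psi=\int x\,|\Psi|^2dx/\int|\Psi|^2dx$ (for states with $\int|x||\Psi|^2dx<\infty$). A state $\Psi$ is a solitary wave if for every $\varepsilon>0$ there is $R>0$ such that for all $t\in\mathbb{R}$, $\int|U_t\Psi|^2dx-\int_{B_R(q_\Psi(t))}|U_t\Psi|^2dx<\varepsilon$, where $q_\Psi(t)$ is the barycenter of $U_t\Psi$. An invariant set $G\subset X$ is stable if for every $\varepsilon>0$ there is $\delta>0$ such that $d(\Psi,G)<\delta$ implies $d(U_t\Psi,G)<\varepsilon$ for all $t\in\mathbb{R}$. A state $\Psi_0$ is orbitally stable if it belongs to a finite dimensional manifold $G\subset X$ that is invariant and stable. A soliton is an orbitally stable solitary wave $\Psi_0\neq0$; it is hylomorphic if $\Lambda(\Psi_0)<1$. A hylomorphic soliton of the form $\psi(t,x)=u(x)e^{-i\omega t}$ is a finite energy solution of the equation of this form, with $u\ge0$ and $u\in H^1(\mathbb{R}^n)$, whose state $(u,-i\omega u)\in X$ is a hylomorphic soliton. Without loss of generality the convention $\mathcal{H}<0$, $\omega>0$ is adopted. *)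

theory Defs
  imports "HOL-Analysis.Analysis" "HOL-Probability.Essential_Supremum"
begin

section \<open>The space L2\<close>

definition sq_integrable :: "(real^'n \<Rightarrow> complex) \<Rightarrow> bool" where
  "sq_integrable f \<longleftrightarrow>
     f \<in> borel_measurable lebesgue \<and> integrable lebesgue (\<lambda>x. (cmod (f x))\<^sup>2)"

lemma sq_integrable_0: "sq_integrable (\<lambda>x. 0)"
  by (simp add: sq_integrable_def)

lemma sq_integrable_add:
  assumes "sq_integrable f" "sq_integrable g"
  shows "sq_integrable (\<lambda>x. f x + g x)"
proof -
  have m[measurable]: "f \<in> borel_measurable lebesgue" "g \<in> borel_measurable lebesgue"
    using assms by (auto simp: sq_integrable_def)
  have I: "integrable lebesgue (\<lambda>x. 2 * (cmod (f x))\<^sup>2 + 2 * (cmod (g x))\<^sup>2)"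
    using assms by (auto simp: sq_integrable_def)
  have "(cmod (f x + g x))\<^sup>2 \<le> 2 * (cmod (f x))\<^sup>2 + 2 * (cmod (g x))\<^sup>2" for x
  proof -
    have "(cmod (f x + g x))\<^sup>2 \<le> (cmod (f x) + cmod (g x))\<^sup>2"
      by (intro power_mono norm_triangle_ineq) auto
    also have "\<dots> \<le> 2 * (cmod (f x))\<^sup>2 + 2 * (cmod (g x))\<^sup>2"
      using sum_squares_bound[of "cmod (f x)" "cmod (g x)"]
      by (simp add: power2_eq_square algebra_simps)
    finally show ?thesis .
  qed
  then have "norm ((cmod (f x + g x))\<^sup>2)
      \<le> norm (2 * (cmod (f x))\<^sup>2 + 2 * (cmod (g x))\<^sup>2)" for x
    by simp
  then have "integrable lebesgue (\<lambda>x. (cmod (f x + g x))\<^sup>2)"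
    by (intro Bochner_Integration.integrable_bound[OF I _ AE_I2]) measurable
  then show ?thesis
    unfolding sq_integrable_def by (intro conjI) measurable
qed

lemma sq_integrable_scaleR: "sq_integrable f \<Longrightarrow> sq_integrable (\<lambda>x. r *\<^sub>R f x)"
  by (auto simp: sq_integrable_def power_mult_distrib)

lemma sq_integrable_uminus: "sq_integrable f \<Longrightarrow> sq_integrable (\<lambda>x. - f x)"
  using sq_integrable_scaleR[of f "-1"] by simp

lemma sq_integrable_diff:
  "sq_integrable f \<Longrightarrow> sq_integrable g \<Longrightarrow> sq_integrable (\<lambda>x. f x - g x)"
  using sq_integrable_add[of f "\<lambda>x. - g x"] sq_integrable_uminus[of g] by simp

lemma integrable_inner_sq_integrable:
  assumes "sq_integrable f" "sq_integrable g"
  shows "integrable lebesgue (\<lambda>x. f x \<bullet> g x)"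
proof -
  have m[measurable]: "f \<in> borel_measurable lebesgue" "g \<in> borel_measurable lebesgue"
    using assms by (auto simp: sq_integrable_def)
  have I: "integrable lebesgue (\<lambda>x. (cmod (f x))\<^sup>2 + (cmod (g x))\<^sup>2)"
    using assms by (auto simp: sq_integrable_def)
  have "norm (f x \<bullet> g x) \<le> norm ((cmod (f x))\<^sup>2 + (cmod (g x))\<^sup>2)" for x
    using Cauchy_Schwarz_ineq2[of "f x" "g x"] sum_squares_bound[of "cmod (f x)" "cmod (g x)"]
      mult_nonneg_nonneg[OF norm_ge_zero[of "f x"] norm_ge_zero[of "g x"]]
    by simp
  then show ?thesis
    by (intro Bochner_Integration.integrable_bound[OF I _ AE_I2]) measurable
qed

quotient_type (overloaded) 'n l2 = "real^'n \<Rightarrow> complex" / partial: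
  "\<lambda>f g. sq_integrable f \<and> sq_integrable g \<and> (AE x in lebesgue. f x = g x)"
proof (rule part_equivpI)
  show "\<exists>f::real^'n \<Rightarrow> complex.
      sq_integrable f \<and> sq_integrable f \<and> (AE x in lebesgue. f x = f x)"
    by (rule exI[of _ "\<lambda>x. 0"]) (simp add: sq_integrable_0)
next
  show "symp (\<lambda>f g :: real^'n \<Rightarrow> complex.
      sq_integrable f \<and> sq_integrable g \<and> (AE x in lebesgue. f x = g x))"
    by (rule sympI) (simp add: eq_commute)
next
  show "transp (\<lambda>f g :: real^'n \<Rightarrow> complex.
      sq_integrable f \<and> sq_integrable g \<and> (AE x in lebesgue. f x = g x))"
  proof (rule transpI, elim conjE, intro conjI)
    fix f g h :: "real^'n \<Rightarrow> complex"
    assume "AE x in lebesgue. f x = g x" "AE x in lebesgue. g x = h x"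
    then show "AE x in lebesgue. f x = h x" by eventually_elim simp
  qed
qed

text \<open>The class of a square integrable function, and a representative of a class. Everything below
  is invariant under changing representatives on a null set.\<close>

definition l2_of :: "(real^'n \<Rightarrow> complex) \<Rightarrow> 'n l2" where
  "l2_of = abs_l2"

definition l2_fun :: "'n l2 \<Rightarrow> real^'n \<Rightarrow> complex" where
  "l2_fun = rep_l2"

lemma AE_eq_map: "AE x in M. f x = f' x \<Longrightarrow> AE x in M. h (f x) = h (f' x)"
  by (auto elim: eventually_mono)

lemma AE_eq_map2:
  assumes "AE x in M. f x = f' x" "AE x in M. g x = g' x"
  shows "AE x in M. h (f x) (g x) = h (f' x) (g' x)"
  using assms by eventually_elim simp

instantiation l2 :: (finite) real_inner
begin

lift_definition zero_l2 :: "'a l2" is "\<lambda>x. 0"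
  by (simp add: sq_integrable_0)

lift_definition plus_l2 :: "'a l2 \<Rightarrow> 'a l2 \<Rightarrow> 'a l2" is "\<lambda>f g x. f x + g x"
  by (intro conjI sq_integrable_add AE_eq_map2[where h = "(+)"]) simp_all

lift_definition minus_l2 :: "'a l2 \<Rightarrow> 'a l2 \<Rightarrow> 'a l2" is "\<lambda>f g x. f x - g x"
  by (intro conjI sq_integrable_diff AE_eq_map2[where h = "(-)"]) simp_all

lift_definition uminus_l2 :: "'a l2 \<Rightarrow> 'a l2" is "\<lambda>f x. - f x"
  by (intro conjI sq_integrable_uminus AE_eq_map[where h = uminus]) simp_all

lift_definition scaleR_l2 :: "real \<Rightarrow> 'a l2 \<Rightarrow> 'a l2" is "\<lambda>r f x. r *\<^sub>R f x"
  by (intro conjI sq_integrable_scaleR AE_eq_map[where h = "scaleR r" for r]) simp_all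

lift_definition inner_l2 :: "'a l2 \<Rightarrow> 'a l2 \<Rightarrow> real" is "\<lambda>f g. LINT x|lebesgue. f x \<bullet> g x"
  by (intro integral_cong_AE AE_eq_map2[where h = inner]) (auto simp: sq_integrable_def)

definition norm_l2 :: "'a l2 \<Rightarrow> real" where "norm_l2 f = sqrt (f \<bullet> f)"
definition sgn_l2 :: "'a l2 \<Rightarrow> 'a l2" where "sgn_l2 f = inverse (norm f) *\<^sub>R f"
definition dist_l2 :: "'a l2 \<Rightarrow> 'a l2 \<Rightarrow> real" where "dist_l2 f g = norm (f - g)"
definition uniformity_l2 :: "('a l2 \<times> 'a l2) filter" where
  "uniformity_l2 = (INF e\<in>{0<..}. principal {(f, g). dist f g < e})"
definition open_l2 :: "'a l2 set \<Rightarrow> bool" where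
  "open_l2 S = (\<forall>f\<in>S. \<forall>\<^sub>F (f', g) in uniformity. f' = f \<longrightarrow> g \<in> S)"

instance
proof
  fix f g h :: "'a l2" and r s :: real
  show "f + g + h = f + (g + h)"
    by transfer (auto simp: add.assoc intro: sq_integrable_add)
  show "f + g = g + f"
    by transfer (auto simp: add.commute intro: sq_integrable_add)
  show "0 + f = f"
    by transfer auto
  show "- f + f = 0"
    by transfer (auto simp: sq_integrable_0)
  show "f - g = f + - g"
    by transfer (auto intro: sq_integrable_diff)
  show "r *\<^sub>R (f + g) = r *\<^sub>R f + r *\<^sub>R g"
    by transfer (auto simp: scaleR_right_distrib intro!: sq_integrable_add sq_integrable_scaleR)
  show "(r + s) *\<^sub>R f = r *\<^sub>R f + s *\<^sub>R f"
    by transfer (auto simp: scaleR_left_distrib intro!: sq_integrable_add sq_integrable_scaleR)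
  show "r *\<^sub>R s *\<^sub>R f = (r * s) *\<^sub>R f"
    by transfer (auto intro: sq_integrable_scaleR)
  show "1 *\<^sub>R f = f"
    by transfer auto
  show "f \<bullet> g = g \<bullet> f"
    by transfer (simp add: inner_commute)
  show "(f + g) \<bullet> h = f \<bullet> h + g \<bullet> h"
    by transfer (simp add: inner_add_left integrable_inner_sq_integrable)
  show "r *\<^sub>R f \<bullet> g = r * (f \<bullet> g)"
    by transfer simp
  show "0 \<le> f \<bullet> f"
    by transfer simp
  show "f \<bullet> f = 0 \<longleftrightarrow> f = 0"
  proof transfer
    fix f :: "real^'a \<Rightarrow> complex"
    assume "sq_integrable f \<and> sq_integrable f \<and> (AE x in lebesgue. f x = f x)"
    then have f: "sq_integrable f" by simp
    have "(LINT x|lebesgue. f x \<bullet> f x) = 0 \<longleftrightarrow> (AE x in lebesgue. f x \<bullet> f x = 0)"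
      by (intro integral_nonneg_eq_0_iff_AE integrable_inner_sq_integrable f) auto
    then show "(LINT x|lebesgue. f x \<bullet> f x) = 0 \<longleftrightarrow>
        sq_integrable f \<and> sq_integrable (\<lambda>x::real^'a. 0::complex) \<and> (AE x in lebesgue. f x = 0)"
      using f by (simp add: sq_integrable_0)
  qed
qed (rule norm_l2_def sgn_l2_def dist_l2_def uniformity_l2_def open_l2_def)+

end


section \<open>The space H1\<close>

definition partial_deriv :: "'n \<Rightarrow> (real^'n \<Rightarrow> real) \<Rightarrow> real^'n \<Rightarrow> real" where
  "partial_deriv i \<phi> x = frechet_derivative \<phi> (at x) (axis i 1)"

definition test_function :: "(real^'n \<Rightarrow> real) \<Rightarrow> bool" where
  "test_function \<phi> \<longleftrightarrow>
     (\<forall>is x. foldr partial_deriv is \<phi> differentiable (at x)) \<and> compact (closure {x. \<phi> x \<noteq> 0})"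

definition weak_partial :: "'n \<Rightarrow> (real^'n \<Rightarrow> complex) \<Rightarrow> (real^'n \<Rightarrow> complex) \<Rightarrow> bool" where
  "weak_partial i f g \<longleftrightarrow>
     (\<forall>\<phi>. test_function \<phi> \<longrightarrow>
        (LINT x|lebesgue. partial_deriv i \<phi> x *\<^sub>R f x) = - (LINT x|lebesgue. \<phi> x *\<^sub>R g x))"

definition in_H1 :: "(real^'n \<Rightarrow> complex) \<Rightarrow> bool" where
  "in_H1 f \<longleftrightarrow> sq_integrable f \<and> (\<forall>i. \<exists>g. sq_integrable g \<and> weak_partial i f g)"

lemma AE_l2_fun_0: "AE x in lebesgue. l2_fun (0::'n::finite l2) x = 0"
proof -
  have "abs_l2 (l2_fun 0) = abs_l2 (\<lambda>x::real^'n. 0::complex)"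
    unfolding l2_fun_def zero_l2_def by (simp add: Quotient_abs_rep[OF Quotient_l2])
  moreover have "sq_integrable (l2_fun (0::'n l2))"
    using Quotient_rep_reflp[OF Quotient_l2, of "0::'n l2"] by (simp add: l2_fun_def)
  ultimately show ?thesis
    using Quotient_rel[OF Quotient_l2, of "l2_fun (0::'n l2)" "\<lambda>x. 0"]
    by (simp add: sq_integrable_0)
qed

lemma in_H1_l2_fun_0: "in_H1 (l2_fun (0::'n::finite l2))"
proof -
  have sq: "sq_integrable (l2_fun (0::'n l2))"
    using Quotient_rep_reflp[OF Quotient_l2, of "0::'n l2"] by (simp add: l2_fun_def)
  have z: "(LINT x|lebesgue. \<phi> x *\<^sub>R l2_fun (0::'n l2) x) = 0" for \<phi> :: "real^'n \<Rightarrow> real"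
    by (rule integral_eq_zero_AE) (use AE_l2_fun_0 in \<open>auto elim: eventually_mono\<close>)
  show ?thesis
    unfolding in_H1_def weak_partial_def
    by (intro conjI allI exI[of _ "\<lambda>x. 0"] impI sq sq_integrable_0) (simp add: z)
qed

typedef (overloaded) 'n h1 = "{f :: ('n::finite) l2. in_H1 (l2_fun f)}"
  morphisms h1_to_l2 Abs_h1
  using in_H1_l2_fun_0 by blast

definition h1_of :: "(real^'n::finite \<Rightarrow> complex) \<Rightarrow> 'n h1" where
  "h1_of f = Abs_h1 (l2_of f)"

definition h1_fun :: "'n::finite h1 \<Rightarrow> real^'n \<Rightarrow> complex" where
  "h1_fun \<psi> = l2_fun (h1_to_l2 \<psi>)"

definition h1_grad :: "'n::finite h1 \<Rightarrow> 'n l2 ^ 'n" where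
  "h1_grad \<psi> = (\<chi> i. THE g. weak_partial i (h1_fun \<psi>) (l2_fun g))"

text \<open>The metric of the H1 norm: the square of the distance is the squared L2 norm of the
  difference plus the squared L2 norms of the differences of the weak partial derivatives.\<close>

instantiation h1 :: (finite) "{zero, metric_space}"
begin

definition zero_h1 :: "'a h1" where "zero_h1 = Abs_h1 0"
definition dist_h1 :: "'a h1 \<Rightarrow> 'a h1 \<Rightarrow> real" where
  "dist_h1 \<psi> \<eta> = dist (h1_to_l2 \<psi>, h1_grad \<psi>) (h1_to_l2 \<eta>, h1_grad \<eta>)"
definition uniformity_h1 :: "('a h1 \<times> 'a h1) filter" where
  "uniformity_h1 = (INF e\<in>{0<..}. principal {(\<psi>, \<eta>). dist \<psi> \<eta> < e})"
definition open_h1 :: "'a h1 set \<Rightarrow> bool" where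
  "open_h1 S = (\<forall>\<psi>\<in>S. \<forall>\<^sub>F (\<psi>', \<eta>) in uniformity. \<psi>' = \<psi> \<longrightarrow> \<eta> \<in> S)"

instance
proof
  fix \<psi> \<eta> \<xi> :: "'a h1"
  show "dist \<psi> \<eta> = 0 \<longleftrightarrow> \<psi> = \<eta>"
    by (auto simp: dist_h1_def h1_to_l2_inject)
  show "dist \<psi> \<eta> \<le> dist \<psi> \<xi> + dist \<eta> \<xi>"
    unfolding dist_h1_def by (rule dist_triangle2)
qed (rule uniformity_h1_def open_h1_def)+

end


section \<open>States and the nonlinear Klein-Gordon evolution\<close>

text \<open>The phase space X, with the product metric; a state is a pair of psi and psi_t.\<close>

type_synonym 'n state = "'n h1 \<times> 'n l2"

abbreviation pos :: "'n::finite state \<Rightarrow> real^'n \<Rightarrow> complex" where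
  "pos \<Psi> \<equiv> h1_fun (fst \<Psi>)"

abbreviation vel :: "'n::finite state \<Rightarrow> real^'n \<Rightarrow> complex" where
  "vel \<Psi> \<equiv> l2_fun (snd \<Psi>)"

abbreviation grad :: "'n::finite state \<Rightarrow> 'n \<Rightarrow> real^'n \<Rightarrow> complex" where
  "grad \<Psi> i \<equiv> l2_fun (h1_grad (fst \<Psi>) $ i)"

text \<open>The profile F lives on the half line; the values of the HOL function at negative arguments
  are irrelevant, and derivatives are taken within the half line (one-sided at 0).\<close>

definition D_half :: "(real \<Rightarrow> real) \<Rightarrow> real \<Rightarrow> real" where
  "D_half F s = vector_derivative F (at s within {0..})"

definition smooth_half :: "(real \<Rightarrow> real) \<Rightarrow> bool" where
  "smooth_half F \<longleftrightarrow> (\<forall>k. \<forall>s\<ge>0. (D_half ^^ k) F differentiable (at s within {0..}))"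

definition W_pot :: "(real \<Rightarrow> real) \<Rightarrow> complex \<Rightarrow> real" where
  "W_pot F z = F (cmod z)"

text \<open>Here \<^term>\<open>sgn z\<close> is z divided by its modulus, and 0 for z = 0.\<close>

definition W_prime :: "(real \<Rightarrow> real) \<Rightarrow> complex \<Rightarrow> complex" where
  "W_prime F z = D_half F (cmod z) *\<^sub>R sgn z"

definition W_i :: "(real \<Rightarrow> real) \<Rightarrow> bool" where
  "W_i F \<longleftrightarrow> (\<forall>s\<ge>0. F s \<ge> 0)"

definition W_ii :: "(real \<Rightarrow> real) \<Rightarrow> bool" where
  "W_ii F \<longleftrightarrow> F 0 = 0 \<and> D_half F 0 = 0 \<and> D_half (D_half F) 0 = 1"

definition W_iii :: "(real \<Rightarrow> real) \<Rightarrow> bool" where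
  "W_iii F \<longleftrightarrow> (INF s\<in>{0<..}. F s / (1/2 * s\<^sup>2)) < 1"

text \<open>Solutions with values in X: continuous curves in X which solve the first-order system
  for (psi, psi_t) tested, at every time, against smooth functions of compact support.\<close>

definition kg_solution :: "(real \<Rightarrow> real) \<Rightarrow> (real \<Rightarrow> 'n::finite state) \<Rightarrow> bool" where
  "kg_solution F \<Psi> \<longleftrightarrow> continuous_on UNIV \<Psi> \<and>
     (\<forall>\<phi> t. test_function \<phi> \<longrightarrow>
        integrable lebesgue (\<lambda>x. \<phi> x *\<^sub>R W_prime F (pos (\<Psi> t) x)) \<and>
        ((\<lambda>t. LINT x|lebesgue. \<phi> x *\<^sub>R pos (\<Psi> t) x) has_vector_derivative
           (LINT x|lebesgue. \<phi> x *\<^sub>R vel (\<Psi> t) x)) (at t) \<and>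
        ((\<lambda>t. LINT x|lebesgue. \<phi> x *\<^sub>R vel (\<Psi> t) x) has_vector_derivative
           - (LINT x|lebesgue. (\<Sum>i\<in>UNIV. partial_deriv i \<phi> x *\<^sub>R grad (\<Psi> t) i x))
           - (LINT x|lebesgue. \<phi> x *\<^sub>R W_prime F (pos (\<Psi> t) x))) (at t))"

text \<open>The time evolution is defined for all times: the Cauchy problem has, for every initial
  state, exactly one global solution, namely the orbit under U.\<close>

definition time_evolution ::
    "(real \<Rightarrow> real) \<Rightarrow> (real \<Rightarrow> 'n::finite state \<Rightarrow> 'n state) \<Rightarrow> bool" where
  "time_evolution F U \<longleftrightarrow>
     (\<forall>\<Psi>. U 0 \<Psi> = \<Psi> \<and> kg_solution F (\<lambda>t. U t \<Psi>) \<and>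
        (\<forall>\<Phi>. kg_solution F \<Phi> \<and> \<Phi> 0 = \<Psi> \<longrightarrow> (\<forall>t. \<Phi> t = U t \<Psi>)))"


section \<open>Energy, charge and solitons\<close>

text \<open>The energy density is nonnegative under \<^const>\<open>W_i\<close>; the energy may be infinite.\<close>

definition energy :: "(real \<Rightarrow> real) \<Rightarrow> 'n::finite state \<Rightarrow> ennreal" where
  "energy F \<Psi> = (\<integral>\<^sup>+ x. ennreal (1/2 * (cmod (vel \<Psi> x))\<^sup>2
       + 1/2 * (\<Sum>i\<in>UNIV. (cmod (grad \<Psi> i x))\<^sup>2) + W_pot F (pos \<Psi> x)) \<partial>lebesgue)"

definition charge :: "'n::finite state \<Rightarrow> real" where
  "charge \<Psi> = (LINT x|lebesgue. Im (vel \<Psi> x * cnj (pos \<Psi> x)))"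

text \<open>For a nonzero state of zero charge the ratio is infinite.\<close>

definition hylomorphy_ratio :: "(real \<Rightarrow> real) \<Rightarrow> 'n::finite state \<Rightarrow> ennreal" where
  "hylomorphy_ratio F \<Psi> = energy F \<Psi> / ennreal \<bar>charge \<Psi>\<bar>"

definition state_density :: "'n::finite state \<Rightarrow> real^'n \<Rightarrow> real" where
  "state_density \<Psi> x = (cmod (pos \<Psi> x))\<^sup>2 + (cmod (vel \<Psi> x))\<^sup>2"

definition has_barycenter :: "'n::finite state \<Rightarrow> bool" where
  "has_barycenter \<Psi> \<longleftrightarrow> integrable lebesgue (\<lambda>x. norm x * state_density \<Psi> x)"

definition barycenter :: "'n::finite state \<Rightarrow> real^'n" where
  "barycenter \<Psi> =
     (LINT x|lebesgue. state_density \<Psi> x *\<^sub>R x) /\<^sub>R (LINT x|lebesgue. state_density \<Psi> x)"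

definition solitary_wave ::
    "(real \<Rightarrow> 'n::finite state \<Rightarrow> 'n state) \<Rightarrow> 'n state \<Rightarrow> bool" where
  "solitary_wave U \<Psi> \<longleftrightarrow>
     (\<forall>t. has_barycenter (U t \<Psi>)) \<and>
     (\<forall>\<epsilon>>0. \<exists>R>0. \<forall>t.
        (LINT x|lebesgue. state_density (U t \<Psi>) x)
        - (LINT x:ball (barycenter (U t \<Psi>)) R|lebesgue. state_density (U t \<Psi>) x) < \<epsilon>)"

text \<open>Finite dimensional topological manifolds; the Hausdorff property and second countability
  are automatic for subsets of the separable metric space X.\<close>

definition finite_dim_manifold :: "'a::metric_space set \<Rightarrow> bool" where
  "finite_dim_manifold G \<longleftrightarrow>
     (\<exists>k. \<forall>p\<in>G. \<exists>V Q. p \<in> V \<and> openin (top_of_set G) V \<and> openin (Euclidean_space k) Q \<and>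
        top_of_set V homeomorphic_space subtopology (Euclidean_space k) Q)"

definition invariant_set ::
    "(real \<Rightarrow> 'n::finite state \<Rightarrow> 'n state) \<Rightarrow> 'n state set \<Rightarrow> bool" where
  "invariant_set U G \<longleftrightarrow> (\<forall>\<Psi>\<in>G. \<forall>t. U t \<Psi> \<in> G)"

definition stable_set ::
    "(real \<Rightarrow> 'n::finite state \<Rightarrow> 'n state) \<Rightarrow> 'n state set \<Rightarrow> bool" where
  "stable_set U G \<longleftrightarrow>
     (\<forall>\<epsilon>>0. \<exists>\<delta>>0. \<forall>\<Psi>. infdist \<Psi> G < \<delta> \<longrightarrow> (\<forall>t. infdist (U t \<Psi>) G < \<epsilon>))"

definition orbitally_stable ::
    "(real \<Rightarrow> 'n::finite state \<Rightarrow> 'n state) \<Rightarrow> 'n state \<Rightarrow> bool" where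
  "orbitally_stable U \<Psi> \<longleftrightarrow>
     (\<exists>G. \<Psi> \<in> G \<and> finite_dim_manifold G \<and> invariant_set U G \<and> stable_set U G)"

definition soliton :: "(real \<Rightarrow> 'n::finite state \<Rightarrow> 'n state) \<Rightarrow> 'n state \<Rightarrow> bool" where
  "soliton U \<Psi> \<longleftrightarrow> \<Psi> \<noteq> 0 \<and> solitary_wave U \<Psi> \<and> orbitally_stable U \<Psi>"

definition hylomorphic_soliton ::
    "(real \<Rightarrow> real) \<Rightarrow> (real \<Rightarrow> 'n::finite state \<Rightarrow> 'n state) \<Rightarrow> 'n state \<Rightarrow> bool" where
  "hylomorphic_soliton F U \<Psi> \<longleftrightarrow> soliton U \<Psi> \<and> hylomorphy_ratio F \<Psi> < 1"

definition standing_wave :: "(real^'n \<Rightarrow> real) \<Rightarrow> real \<Rightarrow> real \<Rightarrow> real^'n \<Rightarrow> complex" where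
  "standing_wave u \<omega> t x = of_real (u x) * exp (- \<i> * of_real (\<omega> * t))"

definition standing_wave_state ::
    "(real^'n::finite \<Rightarrow> real) \<Rightarrow> real \<Rightarrow> real \<Rightarrow> 'n state" where
  "standing_wave_state u \<omega> t =
     (h1_of (standing_wave u \<omega> t), l2_of (\<lambda>x. - \<i> * of_real \<omega> * standing_wave u \<omega> t x))"

text \<open>The sign convention for the frequency makes the charge negative. At time 0 the state is
  (u, - i omega u).\<close>

definition hylomorphic_standing_wave ::
    "(real \<Rightarrow> real) \<Rightarrow> (real \<Rightarrow> 'n::finite state \<Rightarrow> 'n state) \<Rightarrow> (real^'n \<Rightarrow> real) \<Rightarrow> real \<Rightarrow> bool"
  where
  "hylomorphic_standing_wave F U u \<omega> \<longleftrightarrow>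
     in_H1 (\<lambda>x. of_real (u x)) \<and> (AE x in lebesgue. u x \<ge> 0) \<and> \<omega> > 0 \<and>
     kg_solution F (standing_wave_state u \<omega>) \<and>
     (\<forall>t. energy F (standing_wave_state u \<omega> t) < \<infinity>) \<and>
     hylomorphic_soliton F U (standing_wave_state u \<omega> 0)"

definition type_alpha ::
    "(real \<Rightarrow> real) \<Rightarrow> (real \<Rightarrow> 'n::finite state \<Rightarrow> 'n state) \<Rightarrow> bool" where
  "type_alpha F U \<longleftrightarrow>
     (\<exists>a>0. \<forall>u \<omega>. hylomorphic_standing_wave F U u \<omega> \<longrightarrow>
        (\<forall>t. ereal a \<le> esssup lebesgue (\<lambda>x. ereal (cmod (standing_wave u \<omega> t x)))))"

end

theory Submission
  imports Defs
begin

text \<open>A wave of sup norm below \<open>\<alpha>\<^sub>0\<close> only sees the region where W dominates the quadratic potential,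
  so its energy density is pointwise at least \<open>(\<omega>\<^sup>2 + 1) u\<^sup>2 / 2 \<ge> \<omega> u\<^sup>2\<close>, which is the density
  of the absolute value of its charge. Hence its hylomorphy ratio is at least 1, and \<open>\<alpha>\<^sub>0\<close> itself
  bounds the sup norm of hylomorphic standing waves from below.\<close>

lemma sq_integrable_l2_fun: "sq_integrable (l2_fun (f :: 'n::finite l2))"
  using Quotient_rep_reflp[OF Quotient_l2, of f] by (simp add: l2_fun_def)

text \<open>The representative is chosen arbitrarily in the class, so equality off a null set is all
  that survives the passage to the class and back. Both functions are square integrable with the
  same class, hence related by the quotient relation.\<close>

lemma AE_l2_fun_l2_of:
  fixes f :: "real^'n::finite \<Rightarrow> complex"
  assumes "sq_integrable f"
  shows "AE x in lebesgue. l2_fun (l2_of f) x = f x"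
proof -
  have "abs_l2 (l2_fun (l2_of f)) = abs_l2 f"
    unfolding l2_fun_def l2_of_def by (simp add: Quotient_abs_rep[OF Quotient_l2])
  then show ?thesis
    using Quotient_rel[OF Quotient_l2, of "l2_fun (l2_of f)" f] sq_integrable_l2_fun[of "l2_of f"] assms
    by simp
qed

lemma l2_of_eq_0:
  fixes f :: "real^'n::finite \<Rightarrow> complex"
  assumes "sq_integrable f" "AE x in lebesgue. f x = 0"
  shows "l2_of f = 0"
  using Quotient_rel[OF Quotient_l2, of f "\<lambda>x. 0"] assms
  by (simp add: l2_of_def zero_l2_def sq_integrable_0)

lemma partial_deriv_test_function_measurable:
  fixes \<phi> :: "real^'n::finite \<Rightarrow> real"
  assumes "test_function \<phi>"
  shows "partial_deriv i \<phi> \<in> borel_measurable lebesgue"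
proof -
  \<comment> \<open>The one-element list selects the first derivative from the iterated ones; its
    differentiability makes it continuous, hence Borel.\<close>
  have "foldr partial_deriv [i] \<phi> differentiable (at x)" for x
    using assms unfolding test_function_def by blast
  then have "continuous_on UNIV (partial_deriv i \<phi>)"
    by (auto intro!: continuous_at_imp_continuous_on differentiable_imp_continuous_within)
  then have "partial_deriv i \<phi> \<in> borel_measurable borel"
    by (rule borel_measurable_continuous_onI)
  then show ?thesis
    by (intro measurable_completion) simp
qed

text \<open>Weak derivatives see the function only through integrals against test functions. This
  lets a weak derivative of a function serve for the chosen representative of its class.\<close>

lemma weak_partial_cong_AE:
  fixes f f' g :: "real^'n::finite \<Rightarrow> complex"
  assumes m [measurable]: "f \<in> borel_measurable lebesgue" "f' \<in> borel_measurable lebesgue"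
    and eq: "AE x in lebesgue. f x = f' x"
    and w: "weak_partial i f g"
  shows "weak_partial i f' g"
proof -
  have "(LINT x|lebesgue. partial_deriv i \<phi> x *\<^sub>R f' x) = (LINT x|lebesgue. partial_deriv i \<phi> x *\<^sub>R f x)"
    if "test_function \<phi>" for \<phi>
  proof (rule integral_cong_AE)
    have [measurable]: "partial_deriv i \<phi> \<in> borel_measurable lebesgue"
      by (rule partial_deriv_test_function_measurable[OF that])
    show "(\<lambda>x. partial_deriv i \<phi> x *\<^sub>R f' x) \<in> borel_measurable lebesgue"
      "(\<lambda>x. partial_deriv i \<phi> x *\<^sub>R f x) \<in> borel_measurable lebesgue"
      by measurable
    show "AE x in lebesgue. partial_deriv i \<phi> x *\<^sub>R f' x = partial_deriv i \<phi> x *\<^sub>R f x"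
      using eq by eventually_elim simp
  qed
  then show ?thesis
    using w by (simp add: weak_partial_def)
qed

lemma AE_h1_fun_h1_of:
  fixes f :: "real^'n::finite \<Rightarrow> complex"
  assumes "in_H1 f"
  shows "AE x in lebesgue. h1_fun (h1_of f) x = f x"
proof -
  have sq: "sq_integrable f"
    using assms by (simp add: in_H1_def)
  have ae: "AE x in lebesgue. f x = l2_fun (l2_of f) x"
    using AE_l2_fun_l2_of[OF sq] by eventually_elim simp
  \<comment> \<open>\<open>Abs_h1\<close> can be inverted only on classes whose chosen
    representative lies in H1; the weak derivatives of \<open>f\<close> are reused for it.\<close>
  have "in_H1 (l2_fun (l2_of f))"
    unfolding in_H1_def
  proof (intro conjI allI sq_integrable_l2_fun)
    fix i
    obtain g where "sq_integrable g" "weak_partial i f g"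
      using assms unfolding in_H1_def by blast
    moreover have "weak_partial i (l2_fun (l2_of f)) g"
      using sq sq_integrable_l2_fun[of "l2_of f"]
      by (intro weak_partial_cong_AE[OF _ _ ae \<open>weak_partial i f g\<close>])
        (simp_all add: sq_integrable_def)
    ultimately show "\<exists>g. sq_integrable g \<and> weak_partial i (l2_fun (l2_of f)) g"
      by blast
  qed
  then show ?thesis
    using AE_l2_fun_l2_of[OF sq] by (simp add: h1_fun_def h1_of_def Abs_h1_inverse)
qed

text \<open>The gradient term is dropped and the remaining energy density is compared with the
  charge density almost everywhere. Working in \<open>ennreal\<close> covers infinite energy as
  well.\<close>

lemma hylomorphy_ratio_ge_1:
  fixes u :: "real^'n::finite \<Rightarrow> real"
  assumes H1: "in_H1 (\<lambda>x. of_real (u x))"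
    and nz: "standing_wave_state u \<omega> 0 \<noteq> 0"
    and "\<omega> > 0"
    and F: "AE x in lebesgue. 1/2 * (u x)\<^sup>2 \<le> F \<bar>u x\<bar>"
  shows "hylomorphy_ratio F (standing_wave_state u \<omega> 0) \<ge> 1"
proof -
  let ?\<Psi> = "standing_wave_state u \<omega> 0"
  let ?f = "\<lambda>x. complex_of_real (u x)" and ?g = "\<lambda>x. - \<i> * of_real \<omega> * of_real (u x)"
  have \<Psi>: "?\<Psi> = (h1_of ?f, l2_of ?g)"
    by (simp add: standing_wave_state_def standing_wave_def[abs_def])
  have sqf: "sq_integrable ?f"
    using H1 by (simp add: in_H1_def)
  then have int: "integrable lebesgue (\<lambda>x. (u x)\<^sup>2)"
    by (simp add: sq_integrable_def)
  have [measurable]: "?f \<in> borel_measurable lebesgue"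
    using sqf by (simp add: sq_integrable_def)
  have sqg: "sq_integrable ?g"
    using int by (auto simp: sq_integrable_def norm_mult power_mult_distrib)
  have pos: "AE x in lebesgue. pos ?\<Psi> x = ?f x"
    unfolding \<Psi> using AE_h1_fun_h1_of[OF H1] by simp
  have vel: "AE x in lebesgue. vel ?\<Psi> x = ?g x"
    unfolding \<Psi> using AE_l2_fun_l2_of[OF sqg] by simp
  define I where "I = (LINT x|lebesgue. (u x)\<^sup>2)"
  have "I \<ge> 0"
    by (simp add: I_def)
  \<comment> \<open>A vanishing charge would break the final cancellation, since
    \<open>0 / 0 = 0\<close> in \<open>ennreal\<close>. If \<open>I = 0\<close>, both components are
    the zero class, against \<open>nz\<close>.\<close>
  have "I \<noteq> 0"
  proof
    assume "I = 0"
    then have "AE x in lebesgue. u x = 0"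
      using integral_nonneg_eq_0_iff_AE[OF int] by (simp add: I_def)
    then have "l2_of ?f = 0" "l2_of ?g = 0"
      using sqf sqg by (auto intro!: l2_of_eq_0)
    then show False
      using nz by (simp add: \<Psi> h1_of_def zero_h1_def zero_prod_def)
  qed
  with \<open>I \<ge> 0\<close> have "I > 0"
    by simp
  have "charge ?\<Psi> = (LINT x|lebesgue. - \<omega> * (u x)\<^sup>2)"
    unfolding charge_def
  proof (rule integral_cong_AE)
    have [measurable]: "pos ?\<Psi> \<in> borel_measurable lebesgue" "vel ?\<Psi> \<in> borel_measurable lebesgue"
      using sq_integrable_l2_fun by (auto simp: sq_integrable_def h1_fun_def)
    show "(\<lambda>x. Im (vel ?\<Psi> x * cnj (pos ?\<Psi> x))) \<in> borel_measurable lebesgue"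
      \<comment> \<open>Expanding the imaginary part of the product leaves real and imaginary parts
        of measurable functions.\<close>
      unfolding times_complex.sel cnj.sel by measurable
    show "(\<lambda>x. - \<omega> * (u x)\<^sup>2) \<in> borel_measurable lebesgue"
      using int by auto
    show "AE x in lebesgue. Im (vel ?\<Psi> x * cnj (pos ?\<Psi> x)) = - \<omega> * (u x)\<^sup>2"
      using pos vel by eventually_elim (simp add: power2_eq_square)
  qed
  then have charge: "\<bar>charge ?\<Psi>\<bar> = \<omega> * I"
    using \<open>\<omega> > 0\<close> \<open>I \<ge> 0\<close> by (simp add: I_def abs_mult)
  have "ennreal (\<omega> * I) = (\<integral>\<^sup>+ x. ennreal (\<omega> * (u x)\<^sup>2) \<partial>lebesgue)"
    using int \<open>\<omega> > 0\<close> by (subst nn_integral_eq_integral) (auto simp: I_def)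
  also have "\<dots> \<le> energy F ?\<Psi>"
    unfolding energy_def
  proof (rule nn_integral_mono_AE)
    show "AE x in lebesgue. ennreal (\<omega> * (u x)\<^sup>2) \<le> ennreal (1/2 * (cmod (vel ?\<Psi> x))\<^sup>2
       + 1/2 * (\<Sum>i\<in>UNIV. (cmod (grad ?\<Psi> i x))\<^sup>2) + W_pot F (pos ?\<Psi> x))"
      using pos vel F
    proof eventually_elim
      case (elim x)
      have "0 \<le> (\<Sum>i\<in>UNIV. (cmod (grad ?\<Psi> i x))\<^sup>2)"
        by (intro sum_nonneg) simp
      \<comment> \<open>This is the inequality of means for \<open>\<omega>\<close> and 1, weighted
        by \<open>(u x)\<^sup>2\<close>; it is sharp at \<open>\<omega> = 1\<close>.\<close>
      moreover have "\<omega> * (u x)\<^sup>2 \<le> 1/2 * (\<omega>\<^sup>2 * (u x)\<^sup>2) + 1/2 * (u x)\<^sup>2"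
      proof -
        have "0 \<le> (\<omega> - 1)\<^sup>2 * (u x)\<^sup>2"
          by simp
        then show ?thesis
          by (simp add: power2_diff algebra_simps)
      qed
      ultimately have "\<omega> * (u x)\<^sup>2 \<le> 1/2 * (\<omega>\<^sup>2 * (u x)\<^sup>2)
          + 1/2 * (\<Sum>i\<in>UNIV. (cmod (grad ?\<Psi> i x))\<^sup>2) + F \<bar>u x\<bar>"
        using elim(3) by linarith
      then show ?case
        by (intro ennreal_leI) (simp add: elim(1,2) W_pot_def norm_mult power_mult_distrib)
    qed
  qed
  \<comment> \<open>The left side is 1, because \<open>\<omega> * I\<close> is positive and
    finite.\<close>
  finally have "ennreal (\<omega> * I) / ennreal (\<omega> * I) \<le> hylomorphy_ratio F ?\<Psi>"
    unfolding hylomorphy_ratio_def charge by (rule divide_right_mono_ennreal)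
  then show ?thesis
    using \<open>\<omega> > 0\<close> \<open>I > 0\<close> by (simp add: divide_ennreal)
qed

theorem theorem4p9:
  fixes F N :: "real \<Rightarrow> real"
    and U :: "real \<Rightarrow> 'n::finite state \<Rightarrow> 'n state"
    and \<alpha>\<^sub>0 :: real
  assumes "CARD('n) \<ge> 2"
    and "smooth_half F"
    and "time_evolution F U"
    and "W_i F" and "W_ii F" and "W_iii F"
    and "\<And>s. s \<ge> 0 \<Longrightarrow> F s = 1/2 * s\<^sup>2 + N s"
    and "\<alpha>\<^sub>0 > 0"
    and "\<And>s. s \<in> {0<..<\<alpha>\<^sub>0} \<Longrightarrow> N s > 0"
  shows "type_alpha F U"
  unfolding type_alpha_def
proof (intro exI[of _ \<alpha>\<^sub>0] conjI allI impI \<open>\<alpha>\<^sub>0 > 0\<close>)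
  fix u :: "real^'n \<Rightarrow> real" and \<omega> t :: real
  assume wave: "hylomorphic_standing_wave F U u \<omega>"
  let ?m = "\<lambda>x. ereal (cmod (standing_wave u \<omega> t x))"
  show "ereal \<alpha>\<^sub>0 \<le> esssup lebesgue ?m"
  proof (rule ccontr)
    assume less: "\<not> ereal \<alpha>\<^sub>0 \<le> esssup lebesgue ?m"
    have F_ge: "1/2 * s\<^sup>2 \<le> F s" if "0 \<le> s" "s < \<alpha>\<^sub>0" for s
    proof (cases "s = 0")
      \<comment> \<open>The positivity of \<open>N\<close> is assumed on an open interval only; at
        its left end both sides vanish by \<open>W_ii\<close>.\<close>
      case True
      then show ?thesis
        using \<open>W_ii F\<close> by (simp add: W_ii_def)
    next
      case False
      then show ?thesis
        using that assms(7)[of s] assms(9)[of s] by simp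
    qed
    have "AE x in lebesgue. ?m x \<le> esssup lebesgue ?m"
      by (rule esssup_AE)
    then have "AE x in lebesgue. 1/2 * (u x)\<^sup>2 \<le> F \<bar>u x\<bar>"
    proof eventually_elim
      case (elim x)
      then have "?m x < ereal \<alpha>\<^sub>0"
        using less by (meson le_less_trans not_le)
      \<comment> \<open>The phase factor has modulus 1, so a bound at the single time
        \<open>t\<close> is a bound on the profile and can be used at time 0.\<close>
      then have "\<bar>u x\<bar> < \<alpha>\<^sub>0"
        by (simp add: standing_wave_def norm_mult)
      then show ?case
        using F_ge[of "\<bar>u x\<bar>"] by simp
    qed
    then have "1 \<le> hylomorphy_ratio F (standing_wave_state u \<omega> 0)"
      using wave
      by (intro hylomorphy_ratio_ge_1)
        (auto simp: hylomorphic_standing_wave_def hylomorphic_soliton_def soliton_def)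
    then show False
      using wave by (auto simp: hylomorphic_standing_wave_def hylomorphic_soliton_def)
  qed
qed

end
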